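(* Let $\epsilon\in(0,1]$ be fixed (and known), let $\alpha\in\left[\frac{1+\epsilon}{1+2\epsilon},1\right)$ and $q\in\left[0,\frac{\epsilon}{1+2\epsilon}\right]$. There exist constants $C,m>0$, depending only on $\epsilon,\alpha,q$, such that for all $K\ge2$, $T\ge1$, every $u>0$ and every instance $\underline\nu\in\mathcal H_{\epsilon,u}$, the algorithm AdaR-ETC run with parameters $(\alpha,q)$ (defined in the context; it does not use $u$) satisfies $$R_T(\underline\nu)\ \le\ C\,(1+\log T)^m\,u^{\frac{1}{1+\epsilon}}\,K^{\frac{\epsilon}{1+\epsilon}(1-q)}\,T^{\alpha}.$$
   Context: Bandit model. There are $K\ge 2$ arms and a horizon of $T\ge1$ rounds. An instance is a tuple $\underline\nu=(\nu_1,\dots,\nu_K)$ of probability distributions on $\mathbb R$. Successive pulls of arm $i$ produce i.i.d. rewards from $\nu_i$, independently across arms. At each round $t$ the learner picks an arm $I_t\in\{1,\dots,K\}$ based on the past and observes a reward of that arm. For $\epsilon\in(0,1]$, $u>0$, $$\mathcal H_{\epsilon,u}=\{(\nu_1,\dots,\nu_K):\ \mathbb E_{X\sim\nu_i}[|X|^{1+\epsilon}]\le u\ \text{ for all } i\}.$$ With $\mu_i=\mathbb E_{X\sim\nu_i}[X]$, $\mu^*=\max_i\mu_i$, $\Delta_i=\mu^*-\mu_i$, the expected regret is $R_T(\underline\nu)=\mathbb E\big[\sum_{t=1}^T(\mu^*-\mu_{I_t})\big]$. Algorithm AdaR-ETC (Median-of-Means explore-then-commit). Inputs: $K,T,\epsilon,\alpha,q$.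 Set $$\beta_\alpha=\frac{(1-\alpha)(1+\epsilon)}{\epsilon},\quad B_T=\lceil 8\log(KT^3)\rceil,\quad \widetilde L_T=KB_T+\lceil K^qT^{\beta_\alpha}\rceil,\quad L_T=\min\{T,\widetilde L_T\}.$$ Exploration: for $t=1,\dots,L_T$ play $I_t=1+((t-1)\bmod K)$. Commitment: if $L_T<T$, compute for each arm $i$ the Median-of-Means estimate $\widehat\mu_i^{MoM}$ from its $n_i$ exploration samples, choose $\widehat I^*\in\arg\max_i\widehat\mu_i^{MoM}$, and play $I_t=\widehat I^*$ for $t=L_T+1,\dots,T$. Median-of-Means estimate: given samples $X_{i,1},\dots,X_{i,n_i}$, let $s_i=\lfloor n_i/B_T\rfloor$, form the $B_T$ block averages $\overline X_{i,b}=\frac1{s_i}\sum_{\ell=(b-1)s_i+1}^{bs_i}X_{i,\ell}$, $b=1,\dots,B_T$ (leftover samples are discarded), and let $\widehat\mu_i^{MoM}$ be the $\lceil B_T/2\rceil$-th smallest block average. *)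

theory Defs
  imports "HOL-Probability.Probability"
begin

(* Arms are 1, ..., K. An instance is a family nu of distributions on the reals, of which only
   the members with index in {1..K} matter. *)

definition heavy_tailed_instances :: "nat \<Rightarrow> real \<Rightarrow> real \<Rightarrow> (nat \<Rightarrow> real measure) set"
  where "heavy_tailed_instances K \<epsilon> u =
    {\<nu>. \<forall>i\<in>{1..K}. real_distribution (\<nu> i) \<and>
       (\<integral>\<^sup>+ x. ennreal (\<bar>x\<bar> powr (1 + \<epsilon>)) \<partial>\<nu> i) \<le> ennreal u}"

definition arm_mean :: "(nat \<Rightarrow> real measure) \<Rightarrow> nat \<Rightarrow> real"
  where "arm_mean \<nu> i = (\<integral>x. x \<partial>\<nu> i)"

definition best_mean :: "nat \<Rightarrow> (nat \<Rightarrow> real measure) \<Rightarrow> real"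
  where "best_mean K \<nu> = Max (arm_mean \<nu> ` {1..K})"

(* The l-th pull of arm i yields the coordinate (i, l), l = 1, 2, ..., so that the rewards of an arm
   are i.i.d. and rewards of different arms are independent. *)
definition reward_space :: "nat \<Rightarrow> (nat \<Rightarrow> real measure) \<Rightarrow> (nat \<times> nat \<Rightarrow> real) measure"
  where "reward_space K \<nu> = (\<Pi>\<^sub>M (i, l) \<in> {1..K} \<times> {1..}. \<nu> i)"

definition expected_regret ::
  "nat \<Rightarrow> nat \<Rightarrow> (nat \<Rightarrow> real measure) \<Rightarrow> (nat \<Rightarrow> (nat \<times> nat \<Rightarrow> real) \<Rightarrow> nat) \<Rightarrow> real"
  where "expected_regret K T \<nu> I =
    (\<integral>\<omega>. (\<Sum>t=1..T. best_mean K \<nu> - arm_mean \<nu> (I t \<omega>)) \<partial>reward_space K \<nu>)"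

definition num_blocks :: "nat \<Rightarrow> nat \<Rightarrow> nat"
  where "num_blocks K T = nat \<lceil>8 * ln (real K * real T ^ 3)\<rceil>"

definition explore_exponent :: "real \<Rightarrow> real \<Rightarrow> real"
  where "explore_exponent \<epsilon> \<alpha> = (1 - \<alpha>) * (1 + \<epsilon>) / \<epsilon>"

definition explore_length :: "nat \<Rightarrow> nat \<Rightarrow> real \<Rightarrow> real \<Rightarrow> real \<Rightarrow> nat"
  where "explore_length K T \<epsilon> \<alpha> q =
    min T (K * num_blocks K T
           + nat \<lceil>real K powr q * real T powr explore_exponent \<epsilon> \<alpha>\<rceil>)"

definition round_robin :: "nat \<Rightarrow> nat \<Rightarrow> nat"
  where "round_robin K t = 1 + (t - 1) mod K"

definition num_samples :: "nat \<Rightarrow> nat \<Rightarrow> nat \<Rightarrow> nat"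
  where "num_samples K L i = card {t \<in> {1..L}. round_robin K t = i}"

definition block_mean :: "nat \<Rightarrow> (nat \<Rightarrow> real) \<Rightarrow> nat \<Rightarrow> real"
  where "block_mean s x b = (\<Sum>l = (b - 1) * s + 1..b * s. x l) / real s"

(* The samples are x 1, ..., x n. Lists are indexed from 0, hence the decrement. *)
definition median_of_means :: "nat \<Rightarrow> nat \<Rightarrow> (nat \<Rightarrow> real) \<Rightarrow> real"
  where "median_of_means B n x =
    sort (map (block_mean (n div B) x) [1..<Suc B]) ! (nat \<lceil>real B / 2\<rceil> - 1)"

definition explore_indices :: "nat \<Rightarrow> nat \<Rightarrow> (nat \<times> nat) set"
  where "explore_indices K L = (SIGMA i:{1..K}. {1..num_samples K L i})"

(* The choice of an element of the argmax set is left open: a commitment rule is any measurable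
   function of the exploration data that always returns a maximiser of the estimates, so ties may
   be broken arbitrarily. *)
definition commitment_rule ::
  "nat \<Rightarrow> nat \<Rightarrow> nat \<Rightarrow> ((nat \<times> nat \<Rightarrow> real) \<Rightarrow> nat) \<Rightarrow> bool"
  where "commitment_rule K B L c \<longleftrightarrow>
    c \<in> (\<Pi>\<^sub>M _ \<in> explore_indices K L. borel) \<rightarrow>\<^sub>M count_space UNIV \<and>
    (\<forall>x \<in> space (\<Pi>\<^sub>M _ \<in> explore_indices K L. borel).
       is_arg_max (\<lambda>i. median_of_means B (num_samples K L i) (\<lambda>l. x (i, l)))
         (\<lambda>i. i \<in> {1..K}) (c x))"

definition adar_etc_rule ::
  "nat \<Rightarrow> nat \<Rightarrow> real \<Rightarrow> real \<Rightarrow> real \<Rightarrow> ((nat \<times> nat \<Rightarrow> real) \<Rightarrow> nat) \<Rightarrow> bool"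
  where "adar_etc_rule K T \<epsilon> \<alpha> q c \<longleftrightarrow>
    commitment_rule K (num_blocks K T) (explore_length K T \<epsilon> \<alpha> q) c"

definition adar_etc ::
  "nat \<Rightarrow> nat \<Rightarrow> real \<Rightarrow> real \<Rightarrow> real \<Rightarrow> ((nat \<times> nat \<Rightarrow> real) \<Rightarrow> nat)
    \<Rightarrow> nat \<Rightarrow> (nat \<times> nat \<Rightarrow> real) \<Rightarrow> nat"
  where "adar_etc K T \<epsilon> \<alpha> q c t \<omega> =
    (let L = explore_length K T \<epsilon> \<alpha> q
     in if t \<le> L then round_robin K t else c (restrict \<omega> (explore_indices K L)))"

end

theory Submission
  imports Defs
begin

text \<open>Let \<open>U = u powr (1 / (1 + \<epsilon>))\<close>, so that every gap is at most \<open>4 U\<close>. Truncation shows that an average of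
  \<open>s\<close> samples misses the mean of its arm by more than \<open>19 U s powr (- \<epsilon> / (1 + \<epsilon>))\<close> with probability at most
  1/4; by Hoeffding's inequality for the indicators of bad blocks, the median of \<open>B\<close> block averages does
  so with probability at most \<open>exp (- B / 8) \<le> 1 / (K T\<^sup>3)\<close>. Hence, up to a failure probability \<open>1 / T\<^sup>3\<close>, the
  committed arm loses at most twice this accuracy per round. A block has
  \<open>s \<ge> K powr (q - 1) * T powr \<beta> / (4 B)\<close> samples, so the commitment phase costs at most \<open>38 U\<close> times
  \<open>T s powr (- \<epsilon> / (1 + \<epsilon>)) \<le> 4 B K powr \<gamma> * T powr \<alpha>\<close> with \<open>\<gamma> = \<epsilon> / (1 + \<epsilon>) * (1 - q)\<close>. The conditions on
  \<open>\<alpha>\<close> and \<open>q\<close> amount to \<open>\<beta> \<le> \<alpha>\<close>, \<open>q \<le> \<gamma>\<close> and \<open>1 - \<gamma> \<le> \<alpha>\<close>, which bound the exploration phase by the same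
  expression up to logarithms, also when \<open>K > T\<close> and there is no commitment.\<close>

section \<open>Averages under a \<open>1 + \<epsilon>\<close> moment\<close>

text \<open>Expanding the square leaves only the diagonal: for distinct indices the expectation of
  the product factors by independence and vanishes by centring. Integrability is part of the claim
  because Chebyshev's inequality asks for it.\<close>

lemma (in prob_space) second_moment_sum_indep:
  fixes X :: "'b \<Rightarrow> 'a \<Rightarrow> real"
  assumes fin: "finite I" and indep: "indep_vars (\<lambda>_. borel) X I"
    and int: "\<And>i. i \<in> I \<Longrightarrow> integrable M (X i)"
    and int2: "\<And>i. i \<in> I \<Longrightarrow> integrable M (\<lambda>x. (X i x)\<^sup>2)"
    and mean: "\<And>i. i \<in> I \<Longrightarrow> expectation (X i) = 0"
  shows "integrable M (\<lambda>x. (\<Sum>i\<in>I. X i x)\<^sup>2)"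
    and "expectation (\<lambda>x. (\<Sum>i\<in>I. X i x)\<^sup>2) = (\<Sum>i\<in>I. expectation (\<lambda>x. (X i x)\<^sup>2))"
proof -
  have prod: "integrable M (\<lambda>x. X i x * X j x) \<and>
      expectation (\<lambda>x. X i x * X j x) = (if i = j then expectation (\<lambda>x. (X i x)\<^sup>2) else 0)"
    if "i \<in> I" "j \<in> I" for i j
  proof (cases "i = j")
    case True
    then show ?thesis using int2[OF that(1)] by (simp add: power2_eq_square)
  next
    case False
    have ind: "indep_vars (\<lambda>_. borel) X {i, j}"
      by (rule indep_vars_subset[OF indep]) (use that in auto)
    have I: "integrable M (X k)" if "k \<in> {i, j}" for k
      using that \<open>i \<in> I\<close> \<open>j \<in> I\<close> int by auto
    show ?thesis
      using indep_vars_lebesgue_integral[OF _ ind I] indep_vars_integrable[OF _ ind I]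
        False mean[OF that(1)] by simp
  qed
  have sq: "(\<Sum>i\<in>I. X i x)\<^sup>2 = (\<Sum>i\<in>I. \<Sum>j\<in>I. X i x * X j x)" for x
    by (simp add: power2_eq_square sum_product)
  show "integrable M (\<lambda>x. (\<Sum>i\<in>I. X i x)\<^sup>2)"
    unfolding sq using prod by (intro Bochner_Integration.integrable_sum) auto
  have "expectation (\<lambda>x. (\<Sum>i\<in>I. X i x)\<^sup>2) = (\<Sum>i\<in>I. \<Sum>j\<in>I. expectation (\<lambda>x. X i x * X j x))"
    unfolding sq using prod
    by (subst Bochner_Integration.integral_sum, force)
      (intro sum.cong refl Bochner_Integration.integral_sum, auto)
  also have "\<dots> = (\<Sum>i\<in>I. \<Sum>j\<in>I. if i = j then expectation (\<lambda>x. (X i x)\<^sup>2) else 0)"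
    using prod by (intro sum.cong) auto
  also have "\<dots> = (\<Sum>i\<in>I. expectation (\<lambda>x. (X i x)\<^sup>2))"
    using fin by simp
  finally show "expectation (\<lambda>x. (\<Sum>i\<in>I. X i x)\<^sup>2) = (\<Sum>i\<in>I. expectation (\<lambda>x. (X i x)\<^sup>2))" .
qed

text \<open>Controls the tail beyond a truncation level: there
  \<open>\<bar>x\<bar> powr \<epsilon>\<close> is at least \<open>\<tau> powr \<epsilon>\<close>, so
  the first power is paid for by the moment.\<close>

lemma abs_le_moment_above:
  fixes x \<tau> \<epsilon> :: real
  assumes "0 < \<tau>" "0 \<le> \<epsilon>" "\<tau> \<le> \<bar>x\<bar>"
  shows "\<bar>x\<bar> \<le> \<bar>x\<bar> powr (1 + \<epsilon>) * \<tau> powr (- \<epsilon>)"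
proof -
  have "\<tau> powr \<epsilon> \<le> \<bar>x\<bar> powr \<epsilon>"
    using assms by (intro powr_mono2) auto
  then have "\<bar>x\<bar> * \<tau> powr \<epsilon> \<le> \<bar>x\<bar> * \<bar>x\<bar> powr \<epsilon>"
    by (intro mult_left_mono) auto
  then show ?thesis
    using assms by (simp add: powr_add powr_minus field_simps)
qed

text \<open>The counterpart for the bounded part: the powers missing from the moment,
  \<open>\<bar>x\<bar> powr (1 - \<epsilon>)\<close>, are at most
  \<open>\<tau> powr (1 - \<epsilon>)\<close>, as the exponent is nonnegative for
  \<open>\<epsilon> \<le> 1\<close>.\<close>

lemma square_le_moment_below:
  fixes x \<tau> \<epsilon> :: real
  assumes "\<epsilon> \<le> 1" "\<bar>x\<bar> \<le> \<tau>"
  shows "x\<^sup>2 \<le> \<bar>x\<bar> powr (1 + \<epsilon>) * \<tau> powr (1 - \<epsilon>)"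
proof (cases "x = 0")
  case False
  have "x\<^sup>2 = \<bar>x\<bar> powr 2" using False by (simp add: powr_numeral)
  also have "\<dots> = \<bar>x\<bar> powr (1 + \<epsilon>) * \<bar>x\<bar> powr (1 - \<epsilon>)"
    by (simp flip: powr_add)
  also have "\<dots> \<le> \<bar>x\<bar> powr (1 + \<epsilon>) * \<tau> powr (1 - \<epsilon>)"
    using assms by (intro mult_left_mono powr_mono2) auto
  finally show ?thesis .
qed simp

lemma (in prob_space) integrable_of_moment:
  fixes X :: "'a \<Rightarrow> real"
  assumes [measurable]: "X \<in> borel_measurable M" and "0 < \<epsilon>"
    and int: "integrable M (\<lambda>x. \<bar>X x\<bar> powr (1 + \<epsilon>))"
  shows "integrable M X"
proof (rule Bochner_Integration.integrable_bound)
  show "integrable M (\<lambda>x. 1 + \<bar>X x\<bar> powr (1 + \<epsilon>))" using int by simp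
  have "\<bar>X x\<bar> \<le> 1 + \<bar>X x\<bar> powr (1 + \<epsilon>)" for x
  proof (cases "1 \<le> \<bar>X x\<bar>")
    case True
    then show ?thesis using abs_le_moment_above[of 1 \<epsilon> "X x"] \<open>0 < \<epsilon>\<close> by auto
  next
    case False
    then show ?thesis using powr_ge_zero[of "\<bar>X x\<bar>" "1 + \<epsilon>"] by linarith
  qed
  then show "AE x in M. norm (X x) \<le> norm (1 + \<bar>X x\<bar> powr (1 + \<epsilon>))" by auto
qed measurable

text \<open>Splitting at height \<open>u powr (1 / (1 + \<epsilon>))\<close> balances both parts; compared with Jensen's inequality
  it costs a factor 2.\<close>
lemma (in prob_space) abs_expectation_le_moment:
  fixes X :: "'a \<Rightarrow> real"
  assumes [measurable]: "X \<in> borel_measurable M" and "0 < \<epsilon>" and "0 < u"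
    and int: "integrable M (\<lambda>x. \<bar>X x\<bar> powr (1 + \<epsilon>))"
    and mom: "expectation (\<lambda>x. \<bar>X x\<bar> powr (1 + \<epsilon>)) \<le> u"
  shows "\<bar>expectation X\<bar> \<le> 2 * u powr (1 / (1 + \<epsilon>))"
proof -
  define \<tau> where "\<tau> = u powr (1 / (1 + \<epsilon>))"
  have \<tau>: "\<tau> > 0" using \<open>0 < u\<close> by (simp add: \<tau>_def)
  have "\<bar>X x\<bar> \<le> \<tau> + \<bar>X x\<bar> powr (1 + \<epsilon>) * \<tau> powr (- \<epsilon>)" for x
  proof (cases "\<tau> \<le> \<bar>X x\<bar>")
    case True
    then show ?thesis using abs_le_moment_above[of \<tau> \<epsilon> "X x"] \<open>0 < \<epsilon>\<close> \<tau> by auto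
  next
    case False
    moreover have "0 \<le> \<bar>X x\<bar> powr (1 + \<epsilon>) * \<tau> powr (- \<epsilon>)" by simp
    ultimately show ?thesis by linarith
  qed
  then have "expectation (\<lambda>x. \<bar>X x\<bar>) \<le> expectation (\<lambda>x. \<tau> + \<bar>X x\<bar> powr (1 + \<epsilon>) * \<tau> powr (- \<epsilon>))"
    using integrable_of_moment[OF _ \<open>0 < \<epsilon>\<close> int] int by (intro integral_mono) auto
  also have "\<dots> = \<tau> + expectation (\<lambda>x. \<bar>X x\<bar> powr (1 + \<epsilon>)) * \<tau> powr (- \<epsilon>)"
    using int by (simp add: prob_space)
  also have "\<dots> \<le> \<tau> + u * \<tau> powr (- \<epsilon>)"
    using mom by (intro add_left_mono mult_right_mono) auto
  also have "u * \<tau> powr (- \<epsilon>) = \<tau>"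
  proof -
    have "u = \<tau> powr (1 + \<epsilon>)" using \<open>0 < u\<close> \<open>0 < \<epsilon>\<close> by (simp add: \<tau>_def powr_powr)
    then have "u * \<tau> powr (- \<epsilon>) = \<tau> powr (1 + \<epsilon>) * \<tau> powr (- \<epsilon>)" by simp
    also have "\<dots> = \<tau>" using \<tau> by (simp flip: powr_add)
    finally show ?thesis .
  qed
  finally have "expectation (\<lambda>x. \<bar>X x\<bar>) \<le> 2 * \<tau>" by simp
  then show ?thesis
    unfolding \<tau>_def using integral_abs_bound[of M X] by linarith
qed

text \<open>Truncate at \<open>\<tau> = (s u) powr (1 / (1 + \<epsilon>))\<close>; apply Chebyshev's inequality to the bounded part and
  Markov's inequality to the rest. At this level both errors are of the order \<open>u \<tau> powr (- \<epsilon>)\<close>.\<close>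
lemma (in prob_space) prob_mean_deviation_le:
  fixes X :: "'b \<Rightarrow> 'a \<Rightarrow> real"
  assumes fin: "finite I" and card: "card I = s" and s: "0 < s"
    and indep: "indep_vars (\<lambda>_. borel) X I"
    and \<epsilon>: "0 < \<epsilon>" "\<epsilon> \<le> 1" and u: "0 < u"
    and int: "\<And>i. i \<in> I \<Longrightarrow> integrable M (\<lambda>x. \<bar>X i x\<bar> powr (1 + \<epsilon>))"
    and mom: "\<And>i. i \<in> I \<Longrightarrow> expectation (\<lambda>x. \<bar>X i x\<bar> powr (1 + \<epsilon>)) \<le> u"
    and mean: "\<And>i. i \<in> I \<Longrightarrow> expectation (X i) = \<mu>"
  shows "prob {x \<in> space M. \<bar>(\<Sum>i\<in>I. X i x) / real s - \<mu>\<bar>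
      > 19 * u powr (1 / (1 + \<epsilon>)) * real s powr (- \<epsilon> / (1 + \<epsilon>))} \<le> 1 / 4"
proof -
  define \<tau> where "\<tau> = (real s * u) powr (1 / (1 + \<epsilon>))"
  \<comment> \<open>The common error scale: by \<open>d_eq\<close> it is the claimed accuracy
    without the factor 19.\<close>
  define d where "d = u * \<tau> powr (- \<epsilon>)"
  have \<tau>: "\<tau> > 0" using u s by (simp add: \<tau>_def)
  have su: "real s * u = \<tau> powr (1 + \<epsilon>)" using u s \<epsilon> by (simp add: \<tau>_def powr_powr)
  have d: "d > 0" using u \<tau> by (simp add: d_def)
  have d_eq: "d = u powr (1 / (1 + \<epsilon>)) * real s powr (- \<epsilon> / (1 + \<epsilon>))"
  proof -
    have "d = u powr 1 * (real s powr (- \<epsilon> / (1 + \<epsilon>)) * u powr (- \<epsilon> / (1 + \<epsilon>)))"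
      using u s by (simp add: d_def \<tau>_def powr_powr powr_mult)
    also have "\<dots> = u powr (1 + - \<epsilon> / (1 + \<epsilon>)) * real s powr (- \<epsilon> / (1 + \<epsilon>))"
      by (simp only: powr_add mult_ac)
    also have "1 + - \<epsilon> / (1 + \<epsilon>) = 1 / (1 + \<epsilon>)" using \<epsilon> by (simp add: field_simps)
    finally show ?thesis .
  qed
  \<comment> \<open>Since \<open>s u = \<tau> powr (1 + \<epsilon>)\<close>, a truncated sample has
    second moment at most \<open>s d^2\<close>. The sum of \<open>s\<close> of them then has
    standard deviation at most \<open>s d\<close>, the same scale as the expected total of the
    tails.\<close>
  have var_bound: "u * \<tau> powr (1 - \<epsilon>) = real s * d\<^sup>2"
  proof -
    have "real s * d\<^sup>2 = u * ((real s * u) * (\<tau> powr (- \<epsilon>) * \<tau> powr (- \<epsilon>)))"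
      by (simp add: d_def power2_eq_square)
    also have "(real s * u) * (\<tau> powr (- \<epsilon>) * \<tau> powr (- \<epsilon>)) = \<tau> powr (1 - \<epsilon>)"
      unfolding su by (simp flip: powr_add)
    finally show ?thesis by simp
  qed
  \<comment> \<open>Each sample is split into its bounded part \<open>Y\<close> and its tail
    \<open>Z\<close>; \<open>W\<close> is the centred bounded part.\<close>
  define Y where "Y = (\<lambda>i x. if \<bar>X i x\<bar> \<le> \<tau> then X i x else 0)"
  define Z where "Z = (\<lambda>i x. if \<bar>X i x\<bar> \<le> \<tau> then 0 else X i x)"
  define W where "W = (\<lambda>i x. Y i x - expectation (Y i))"
  have X_meas: "X i \<in> borel_measurable M" if "i \<in> I" for i
    using indep that by (auto simp: indep_vars_def)
  have intX: "integrable M (X i)" if "i \<in> I" for i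
    using integrable_of_moment[OF X_meas[OF that] \<epsilon>(1) int[OF that]] .
  have Y_meas: "Y i \<in> borel_measurable M" and Z_meas: "Z i \<in> borel_measurable M" if "i \<in> I" for i
    using X_meas[OF that] unfolding Y_def Z_def by measurable
  have intY: "integrable M (Y i)" if "i \<in> I" for i
    by (rule Bochner_Integration.integrable_bound[OF intX[OF that] Y_meas[OF that]]) (auto simp: Y_def)
  have intZ: "integrable M (Z i)" if "i \<in> I" for i
    by (rule Bochner_Integration.integrable_bound[OF intX[OF that] Z_meas[OF that]]) (auto simp: Z_def)
  have XYZ: "X i x = Y i x + Z i x" for i x by (simp add: Y_def Z_def)
  have Y2: "(Y i x)\<^sup>2 \<le> \<bar>X i x\<bar> powr (1 + \<epsilon>) * \<tau> powr (1 - \<epsilon>)" for i x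
    using square_le_moment_below[OF \<epsilon>(2)] by (simp add: Y_def)
  have intY2: "integrable M (\<lambda>x. (Y i x)\<^sup>2)" if "i \<in> I" for i
  proof (rule Bochner_Integration.integrable_bound)
    show "integrable M (\<lambda>x. \<bar>X i x\<bar> powr (1 + \<epsilon>) * \<tau> powr (1 - \<epsilon>))"
      using int[OF that] by simp
    show "(\<lambda>x. (Y i x)\<^sup>2) \<in> borel_measurable M"
      using Y_meas[OF that] by measurable
    show "AE x in M. norm ((Y i x)\<^sup>2) \<le> norm (\<bar>X i x\<bar> powr (1 + \<epsilon>) * \<tau> powr (1 - \<epsilon>))"
      using Y2 by (simp add: abs_mult)
  qed
  have EY2: "expectation (\<lambda>x. (Y i x)\<^sup>2) \<le> real s * d\<^sup>2" if "i \<in> I" for i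
  proof -
    have "expectation (\<lambda>x. (Y i x)\<^sup>2) \<le> expectation (\<lambda>x. \<bar>X i x\<bar> powr (1 + \<epsilon>) * \<tau> powr (1 - \<epsilon>))"
      using intY2[OF that] int[OF that] Y2 by (intro integral_mono) auto
    also have "\<dots> \<le> u * \<tau> powr (1 - \<epsilon>)" using mom[OF that] by (simp add: mult_right_mono)
    finally show ?thesis unfolding var_bound .
  qed
  have EZ: "expectation (\<lambda>x. \<bar>Z i x\<bar>) \<le> d" if "i \<in> I" for i
  proof -
    have "\<bar>Z i x\<bar> \<le> \<bar>X i x\<bar> powr (1 + \<epsilon>) * \<tau> powr (- \<epsilon>)" for x
      using abs_le_moment_above[OF \<tau>, of \<epsilon> "X i x"] \<epsilon> by (auto simp: Z_def)
    then have "expectation (\<lambda>x. \<bar>Z i x\<bar>) \<le> expectation (\<lambda>x. \<bar>X i x\<bar> powr (1 + \<epsilon>) * \<tau> powr (- \<epsilon>))"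
      using intZ[OF that] int[OF that] by (intro integral_mono) auto
    also have "\<dots> \<le> d" using mom[OF that] by (simp add: d_def mult_right_mono)
    finally show ?thesis .
  qed
  have W_indep: "indep_vars (\<lambda>_. borel) W I"
    unfolding W_def Y_def
    by (rule indep_vars_compose2[OF indep,
          where Y = "\<lambda>i y. (if \<bar>y\<bar> \<le> \<tau> then y else 0) - expectation (\<lambda>x. if \<bar>X i x\<bar> \<le> \<tau> then X i x else 0)"])
      measurable
  have intW: "integrable M (W i)" if "i \<in> I" for i
    using intY[OF that] by (simp add: W_def)
  have intW2: "integrable M (\<lambda>x. (W i x)\<^sup>2)" if "i \<in> I" for i
    using intY[OF that] intY2[OF that] by (simp add: W_def power2_diff)
  have EW: "expectation (W i) = 0" if "i \<in> I" for i
    using intY[OF that] by (simp add: W_def prob_space)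
  have EW2: "expectation (\<lambda>x. (W i x)\<^sup>2) \<le> real s * d\<^sup>2" if "i \<in> I" for i
  proof -
    have "expectation (\<lambda>x. (W i x)\<^sup>2) = expectation (\<lambda>x. (Y i x)\<^sup>2) - (expectation (Y i))\<^sup>2"
      unfolding W_def using intY[OF that] intY2[OF that] by (intro variance_eq)
    also have "\<dots> \<le> real s * d\<^sup>2"
      using EY2[OF that] zero_le_power2[of "expectation (Y i)"] by linarith
    finally show ?thesis .
  qed
  have W_moment: "integrable M (\<lambda>x. (\<Sum>i\<in>I. W i x)\<^sup>2)"
      "expectation (\<lambda>x. (\<Sum>i\<in>I. W i x)\<^sup>2) = (\<Sum>i\<in>I. expectation (\<lambda>x. (W i x)\<^sup>2))"
    by (intro second_moment_sum_indep[OF fin W_indep]; fact intW intW2 EW)+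
  have "(\<Sum>i\<in>I. expectation (\<lambda>x. (W i x)\<^sup>2)) \<le> of_nat (card I) * (real s * d\<^sup>2)"
    by (rule sum_bounded_above) (rule EW2)
  then have W2: "expectation (\<lambda>x. (\<Sum>i\<in>I. W i x)\<^sup>2) \<le> (real s * d)\<^sup>2"
    unfolding W_moment(2) card by (simp add: power2_eq_square mult_ac)
  have W_meas: "(\<lambda>x. \<Sum>i\<in>I. W i x) \<in> borel_measurable M"
    using intW by (intro borel_measurable_sum) auto
  \<comment> \<open>The thresholds 3 and 8 give failure probabilities 1/9 and 1/8, whose sum is
    below 1/4. Off both events the total error is below \<open>(3 + 8 + 1) s d\<close>, the last
    term being the truncation bias, so 19 leaves room.\<close>
  define A where "A = {x \<in> space M. \<bar>\<Sum>i\<in>I. W i x\<bar> \<ge> 3 * (real s * d)}"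
  define A' where "A' = {x \<in> space M. (\<Sum>i\<in>I. \<bar>Z i x\<bar>) \<ge> 8 * (real s * d)}"
  have sd: "real s * d > 0" using s d by simp
  have "prob A \<le> expectation (\<lambda>x. (\<Sum>i\<in>I. W i x)\<^sup>2) / (3 * (real s * d))\<^sup>2"
    unfolding A_def using W_moment(1) W_meas sd
    by (intro second_moment_method) auto
  also have "\<dots> \<le> (real s * d)\<^sup>2 / (3 * (real s * d))\<^sup>2"
    using W2 by (intro divide_right_mono) auto
  also have "\<dots> = 1 / 9" using s d by (simp add: power_mult_distrib)
  finally have A: "prob A \<le> 1 / 9" .
  have intSZ: "integrable M (\<lambda>x. \<Sum>i\<in>I. \<bar>Z i x\<bar>)"
    using intZ by (intro Bochner_Integration.integrable_sum) auto
  have "expectation (\<lambda>x. \<Sum>i\<in>I. \<bar>Z i x\<bar>) = (\<Sum>i\<in>I. expectation (\<lambda>x. \<bar>Z i x\<bar>))"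
    using intZ by (intro Bochner_Integration.integral_sum) auto
  also have "\<dots> \<le> of_nat (card I) * d" by (rule sum_bounded_above) (rule EZ)
  also have "\<dots> = real s * d" by (simp add: card)
  finally have ESZ: "expectation (\<lambda>x. \<Sum>i\<in>I. \<bar>Z i x\<bar>) \<le> real s * d" .
  have "prob A' \<le> expectation (\<lambda>x. \<Sum>i\<in>I. \<bar>Z i x\<bar>) / (8 * (real s * d))"
    unfolding A'_def using sd
    by (intro integral_Markov_inequality_measure[OF intSZ sets.empty_sets]) (auto simp: sum_nonneg)
  also have "\<dots> \<le> (real s * d) / (8 * (real s * d))"
    using ESZ sd by (intro divide_right_mono) auto
  also have "\<dots> = 1 / 8" using s d by simp
  finally have A': "prob A' \<le> 1 / 8" .
  have meas: "A \<in> sets M" "A' \<in> sets M"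
    using W_meas intSZ unfolding A_def A'_def by measurable
  have "{x \<in> space M. \<bar>(\<Sum>i\<in>I. X i x) / real s - \<mu>\<bar> > 19 * d} \<subseteq> A \<union> A'"
  proof (rule subsetI, rule ccontr)
    fix x assume x: "x \<in> {x \<in> space M. \<bar>(\<Sum>i\<in>I. X i x) / real s - \<mu>\<bar> > 19 * d}" and "x \<notin> A \<union> A'"
    then have w: "\<bar>\<Sum>i\<in>I. W i x\<bar> < 3 * (real s * d)" and z: "(\<Sum>i\<in>I. \<bar>Z i x\<bar>) < 8 * (real s * d)"
      by (auto simp: A_def A'_def)
    have decomp: "X i x - \<mu> = W i x + Z i x - expectation (Z i)" if "i \<in> I" for i
    proof -
      have "\<mu> = expectation (\<lambda>x. Y i x + Z i x)"
        using mean[OF that] by (simp flip: XYZ)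
      also have "\<dots> = expectation (Y i) + expectation (Z i)"
        using intY[OF that] intZ[OF that] by simp
      finally show ?thesis by (simp add: XYZ W_def)
    qed
    have "(\<Sum>i\<in>I. X i x) - real s * \<mu> = (\<Sum>i\<in>I. X i x - \<mu>)"
      by (simp add: sum_subtractf card)
    also have "\<dots> = (\<Sum>i\<in>I. W i x + Z i x - expectation (Z i))"
      by (intro sum.cong refl decomp)
    also have "\<bar>\<dots>\<bar> \<le> \<bar>\<Sum>i\<in>I. W i x\<bar> + (\<Sum>i\<in>I. \<bar>Z i x\<bar>) + (\<Sum>i\<in>I. \<bar>expectation (Z i)\<bar>)"
      using sum_abs[of "\<lambda>i. Z i x" I] sum_abs[of "\<lambda>i. expectation (Z i)" I]
      unfolding sum_subtractf sum.distrib by linarith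
    also have "(\<Sum>i\<in>I. \<bar>expectation (Z i)\<bar>) \<le> of_nat (card I) * d"
      using integral_abs_bound EZ by (intro sum_bounded_above) (rule order_trans)
    also have "\<dots> = real s * d" by (simp add: card)
    finally have "\<bar>(\<Sum>i\<in>I. X i x) - real s * \<mu>\<bar> \<le> 19 * (real s * d)" using w z sd by linarith
    moreover have "(\<Sum>i\<in>I. X i x) - real s * \<mu> = real s * ((\<Sum>i\<in>I. X i x) / real s - \<mu>)"
      using s by (simp add: field_simps)
    ultimately have "real s * \<bar>(\<Sum>i\<in>I. X i x) / real s - \<mu>\<bar> \<le> real s * (19 * d)"
      by (simp add: abs_mult mult_ac)
    then show False using x s by simp
  qed
  then have "prob {x \<in> space M. \<bar>(\<Sum>i\<in>I. X i x) / real s - \<mu>\<bar> > 19 * d} \<le> prob (A \<union> A')"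
    using meas by (intro finite_measure_mono) auto
  also have "\<dots> \<le> prob A + prob A'" using meas by (intro measure_Un_le)
  also have "\<dots> \<le> 1 / 4" using A A' by linarith
  finally show ?thesis unfolding d_eq by (simp add: mult.assoc)
qed

section \<open>Median of means\<close>

text \<open>If entry \<open>k\<close> of the sorted list were too large, so would be all
  \<open>length xs - k\<close> entries from there on; if it were too small, so would be the first
  \<open>k + 1\<close>. Sorting does not change such counts.\<close>

lemma sort_nth_in_interval:
  fixes xs :: "real list"
  assumes k: "k < length xs"
    and above: "length (filter (\<lambda>y. \<mu> + \<delta> < y) xs) < length xs - k"
    and below: "length (filter (\<lambda>y. y < \<mu> - \<delta>) xs) < k + 1"
  shows "\<bar>sort xs ! k - \<mu>\<bar> \<le> \<delta>"
proof -
  let ?ys = "sort xs"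
  have len: "length (filter P xs) = card {i. i < length xs \<and> P (?ys ! i)}" for P
    using length_filter_conv_card[of P ?ys] by (simp add: filter_sort)
  have fin: "finite {i. i < length xs \<and> P (?ys ! i)}" for P by simp
  have "?ys ! k \<le> \<mu> + \<delta>"
  proof (rule ccontr)
    assume "\<not> ?thesis"
    then have "{k..<length xs} \<subseteq> {i. i < length xs \<and> \<mu> + \<delta> < ?ys ! i}"
      using sorted_nth_mono[OF sorted_sort, of k _ xs] by force
    from card_mono[OF fin this] show False using above by (simp add: len)
  qed
  moreover have "\<mu> - \<delta> \<le> ?ys ! k"
  proof (rule ccontr)
    assume "\<not> ?thesis"
    then have "{..k} \<subseteq> {i. i < length xs \<and> ?ys ! i < \<mu> - \<delta>}"
      using sorted_nth_mono[OF sorted_sort, of _ k xs] k by force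
    from card_mono[OF fin this] show False using below by (simp add: len)
  qed
  ultimately show ?thesis by linarith
qed

lemma median_of_means_deviation:
  assumes B: "1 \<le> B"
    and bad: "2 * card {b \<in> {1..B}. \<delta> < \<bar>block_mean (n div B) x b - \<mu>\<bar>} < B"
  shows "\<bar>median_of_means B n x - \<mu>\<bar> \<le> \<delta>"
proof -
  let ?f = "block_mean (n div B) x"
  let ?k = "nat \<lceil>real B / 2\<rceil> - 1"
  \<comment> \<open>With \<open>?k\<close> the zero-based median position, these two inequalities
    make any count below \<open>B / 2\<close> smaller than both \<open>?k + 1\<close> and
    \<open>B - ?k\<close>.\<close>
  have k: "2 * (?k + 1) \<ge> B" "2 * ?k < B"
  proof -
    have "real B / 2 \<le> of_int \<lceil>real B / 2\<rceil>" "of_int \<lceil>real B / 2\<rceil> < real B / 2 + 1" by linarith+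
    then show "2 * (?k + 1) \<ge> B" and "2 * ?k < B" using B by (simp_all, linarith+)
  qed
  \<comment> \<open>Blocks that are too high and blocks that are too low are both among the bad
    ones, so one count serves both sides of the median.\<close>
  have count: "length (filter P (map ?f [1..<Suc B])) \<le> card {b \<in> {1..B}. \<delta> < \<bar>?f b - \<mu>\<bar>}"
    if "\<And>y. P y \<Longrightarrow> \<delta> < \<bar>y - \<mu>\<bar>" for P
  proof -
    have "length (filter P (map ?f [1..<Suc B])) = card (set (filter (P \<circ> ?f) [1..<Suc B]))"
      by (subst distinct_card) (auto simp: filter_map)
    also have "\<dots> \<le> card {b \<in> {1..B}. \<delta> < \<bar>?f b - \<mu>\<bar>}"
      using that by (intro card_mono) (auto simp: less_Suc_eq_le)
    finally show ?thesis .
  qed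
  show ?thesis
    unfolding median_of_means_def
  proof (rule sort_nth_in_interval)
    have "length (filter (\<lambda>y. \<mu> + \<delta> < y) (map ?f [1..<Suc B])) \<le> card {b \<in> {1..B}. \<delta> < \<bar>?f b - \<mu>\<bar>}"
      by (rule count) linarith
    then show "length (filter (\<lambda>y. \<mu> + \<delta> < y) (map ?f [1..<Suc B])) < length (map ?f [1..<Suc B]) - ?k"
      using bad k by simp
    have "length (filter (\<lambda>y. y < \<mu> - \<delta>) (map ?f [1..<Suc B])) \<le> card {b \<in> {1..B}. \<delta> < \<bar>?f b - \<mu>\<bar>}"
      by (rule count) linarith
    then show "length (filter (\<lambda>y. y < \<mu> - \<delta>) (map ?f [1..<Suc B])) < ?k + 1"
      using bad k by linarith
  qed (use k in simp)
qed

text \<open>The conclusion supplies an exceptional event instead of bounding the probability of a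
  large deviation itself; this event is built from block sums, so measurability of the median never
  has to be shown.\<close>

lemma (in prob_space) median_of_means_concentration:
  fixes X :: "nat \<Rightarrow> 'a \<Rightarrow> real"
  assumes B: "1 \<le> B" and s: "1 \<le> n div B"
    and indep: "indep_vars (\<lambda>_. borel) X {1..n}"
    and \<epsilon>: "0 < \<epsilon>" "\<epsilon> \<le> 1" and u: "0 < u"
    and int: "\<And>l. l \<in> {1..n} \<Longrightarrow> integrable M (\<lambda>x. \<bar>X l x\<bar> powr (1 + \<epsilon>))"
    and mom: "\<And>l. l \<in> {1..n} \<Longrightarrow> expectation (\<lambda>x. \<bar>X l x\<bar> powr (1 + \<epsilon>)) \<le> u"
    and mean: "\<And>l. l \<in> {1..n} \<Longrightarrow> expectation (X l) = \<mu>"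
  defines "\<delta> \<equiv> 19 * u powr (1 / (1 + \<epsilon>)) * real (n div B) powr (- \<epsilon> / (1 + \<epsilon>))"
  shows "\<exists>E \<in> events. prob E \<le> exp (- real B / 8) \<and>
    (\<forall>x \<in> space M - E. \<bar>median_of_means B n (\<lambda>l. X l x) - \<mu>\<bar> \<le> \<delta>)"
proof -
  define s where "s = n div B"
  define J where "J b = {(b - 1) * s + 1..b * s}" for b :: nat
  define S where "S b x = (\<Sum>l\<in>J b. X l x) / real s" for b x
  define D where "D b = {x \<in> space M. \<delta> < \<bar>S b x - \<mu>\<bar>}" for b
  have s0: "0 < s" using s by (simp add: s_def)
  have J_sub: "J b \<subseteq> {1..n}" if "b \<in> {1..B}" for b
  proof -
    have "b * s \<le> B * s" using that by (intro mult_le_mono1) auto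
    also have "\<dots> \<le> n" by (simp add: s_def)
    finally show ?thesis by (auto simp: J_def)
  qed
  have J_card: "card (J b) = s" if "b \<in> {1..B}" for b
    using that by (cases b) (auto simp: J_def)
  have J_less: "J b \<inter> J c = {}" if "b < c" for b c
  proof -
    have "b * s \<le> (c - 1) * s" using that by (intro mult_le_mono1) auto
    then have "x \<notin> J c" if "x \<in> J b" for x
      using that \<open>b * s \<le> (c - 1) * s\<close> unfolding J_def atLeastAtMost_iff by linarith
    then show ?thesis by blast
  qed
  have J_disj: "disjoint_family_on J {1..B}"
    unfolding disjoint_family_on_def using J_less by (metis inf_commute linorder_neqE_nat)
  have X_meas: "X l \<in> borel_measurable M" if "l \<in> {1..n}" for l
    using indep that by (auto simp: indep_vars_def)
  have S_meas: "S b \<in> borel_measurable M" if "b \<in> {1..B}" for b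
    unfolding S_def using J_sub[OF that] X_meas
    by (intro borel_measurable_divide borel_measurable_sum) auto
  have D_meas: "D b \<in> events" if "b \<in> {1..B}" for b
    unfolding D_def using S_meas[OF that] by measurable
  have D_prob: "prob (D b) \<le> 1 / 4" if b: "b \<in> {1..B}" for b
    unfolding D_def S_def \<delta>_def s_def[symmetric]
  proof (rule prob_mean_deviation_le[OF _ J_card[OF b] s0 _ \<epsilon> u])
    show "indep_vars (\<lambda>_. borel) X (J b)" by (rule indep_vars_subset[OF indep J_sub[OF b]])
  qed (use J_sub[OF b] int mom mean in \<open>auto simp: J_def\<close>)
  define V where "V b = (\<lambda>x. if \<delta> < \<bar>S b x - \<mu>\<bar> then 1 else 0 :: real)" for b
  \<comment> \<open>The indicator of a bad block depends only on the samples of that block, and the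
    blocks are disjoint. The \<open>restrict\<close> presents it as a function on the product space
    over \<open>J b\<close>.\<close>
  have "indep_vars (\<lambda>_. borel)
      (\<lambda>b x. if \<delta> < \<bar>(\<Sum>l\<in>J b. restrict (\<lambda>l. X l x) (J b) l) / real s - \<mu>\<bar> then 1 else 0 :: real) {1..B}"
    by (rule indep_vars_compose2[OF indep_vars_restrict[OF indep J_sub J_disj],
          where Y = "\<lambda>b y. if \<delta> < \<bar>(\<Sum>l\<in>J b. y l) / real s - \<mu>\<bar> then 1 else 0"]) measurable
  then have V_indep: "indep_vars (\<lambda>_. borel) V {1..B}"
    unfolding V_def S_def by (simp cong: sum.cong)
  interpret H: Hoeffding_ineq M "{1..B}" V "\<lambda>_. 0" "\<lambda>_. 1" "\<Sum>b\<in>{1..B}. expectation (V b)"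
  proof unfold_locales
    show "AE x in M. V b x \<in> {0..1}" if "b \<in> {1..B}" for b by (simp add: V_def)
  qed (rule V_indep | simp)+
  define E where "E = {x \<in> space M. (\<Sum>b\<in>{1..B}. V b x) \<ge> (\<Sum>b\<in>{1..B}. expectation (V b)) + real B / 4}"
  \<comment> \<open>Hoeffding with excess \<open>B / 4\<close> and \<open>B\<close> variables of
    range 1 gives the exponent \<open>- 2 (B / 4)^2 / B = - B / 8\<close>. As the expected number of
    bad blocks is at most \<open>B / 4\<close>, fewer than \<open>B / 2\<close> are bad off
    \<open>E\<close>.\<close>
  have "prob E \<le> exp (- 2 * (real B / 4)\<^sup>2 / (\<Sum>b\<in>{1..B}. (1 - 0)\<^sup>2))"
    unfolding E_def by (rule H.Hoeffding_ineq_ge) (use B in auto)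
  also have "\<dots> = exp (- real B / 8)"
    using B by (simp add: power2_eq_square)
  finally have E_prob: "prob E \<le> exp (- real B / 8)" .
  have "(\<lambda>x. \<Sum>b\<in>{1..B}. V b x) \<in> borel_measurable M"
    using H.random_variable by (intro borel_measurable_sum) auto
  then have E_meas: "E \<in> events" unfolding E_def by measurable
  have EV: "(\<Sum>b\<in>{1..B}. expectation (V b)) \<le> real B / 4"
  proof -
    have "expectation (V b) \<le> 1 / 4" if b: "b \<in> {1..B}" for b
    proof -
      have "expectation (V b) = expectation (indicator (D b))"
        by (intro Bochner_Integration.integral_cong) (auto simp: V_def D_def)
      then show ?thesis using D_meas[OF b] D_prob[OF b] by simp
    qed
    then have "(\<Sum>b\<in>{1..B}. expectation (V b)) \<le> of_nat (card {1..B}) * (1 / 4)"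
      by (rule sum_bounded_above)
    then show ?thesis by simp
  qed
  have "\<bar>median_of_means B n (\<lambda>l. X l x) - \<mu>\<bar> \<le> \<delta>" if x: "x \<in> space M - E" for x
  proof (rule median_of_means_deviation[OF B])
    have "(\<Sum>b\<in>{1..B}. V b x) = real (card {b \<in> {1..B}. \<delta> < \<bar>S b x - \<mu>\<bar>})"
      by (simp add: V_def sum.If_cases Int_def)
    moreover have "(\<Sum>b\<in>{1..B}. V b x) < real B / 2"
      using x EV by (auto simp: E_def)
    moreover have "block_mean (n div B) (\<lambda>l. X l x) b = S b x" for b
      by (simp add: block_mean_def S_def J_def s_def)
    ultimately show "2 * card {b \<in> {1..B}. \<delta> < \<bar>block_mean (n div B) (\<lambda>l. X l x) b - \<mu>\<bar>} < B"
      by simp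
  qed
  with E_meas E_prob show ?thesis by blast
qed

text \<open>Independence means that the joint law is the product of the marginals; for distinct
  coordinates of a product measure this is reindexing along \<open>f\<close>. The empty family is
  treated apart because that characterisation is for nonempty index sets.\<close>

lemma indep_vars_PiM_coordinates:
  assumes M: "\<And>i. i \<in> I \<Longrightarrow> prob_space (M i)" and f: "inj_on f J" "f \<in> J \<rightarrow> I"
  shows "prob_space.indep_vars (PiM I M) (\<lambda>j. M (f j)) (\<lambda>j \<omega>. \<omega> (f j)) J"
proof -
  interpret P: prob_space "PiM I M" by (rule prob_space_PiM) (rule M)
  show ?thesis
  proof (cases "J = {}")
    case True
    then show ?thesis unfolding P.indep_vars_def P.indep_sets_def by simp
  next
    case False
    have "distr (PiM I M) (PiM J (\<lambda>j. M (f j))) (\<lambda>\<omega>. \<lambda>j\<in>J. \<omega> (f j)) = PiM J (\<lambda>j. M (f j))"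
      by (rule distr_PiM_reindex[OF M f])
    also have "\<dots> = PiM J (\<lambda>j. distr (PiM I M) (M (f j)) (\<lambda>\<omega>. \<omega> (f j)))"
      using f(2) by (intro PiM_cong refl distr_PiM_component[symmetric] M) auto
    finally show ?thesis
      using f(2) by (subst P.indep_vars_iff_distr_eq_PiM'[OF False])
        (auto intro!: measurable_component_singleton)
  qed
qed

section \<open>Exploration length and block size\<close>

text \<open>The remainder is smaller than \<open>b\<close>, and \<open>b\<close> is at most
  \<open>b * (n div b)\<close>. Rounding down a quotient that is at least 1 thus costs at most a
  factor 2.\<close>

lemma div_ge_half:
  fixes n b :: nat
  assumes "0 < b" "b \<le> n"
  shows "real n / (2 * real b) \<le> real (n div b)"
proof -
  have "1 \<le> n div b" using assms by (simp add: Suc_le_eq div_greater_zero_iff)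
  then have "b * 1 \<le> b * (n div b)" by (intro mult_le_mono2)
  moreover have "n < b + b * (n div b)"
    using mult_div_mod_eq[of b n] mod_less_divisor[OF assms(1), of n] by linarith
  ultimately have "n \<le> 2 * (b * (n div b))" by linarith
  then have "real n \<le> 2 * (real b * real (n div b))"
    by (metis of_nat_le_iff of_nat_mult of_nat_numeral)
  then show ?thesis using assms by (simp add: field_simps)
qed

lemma nat_ceiling_le_add_one:
  fixes x :: real
  assumes "0 \<le> x"
  shows "real (nat \<lceil>x\<rceil>) \<le> x + 1"
  using of_int_ceiling_le_add_one[of x] assms by simp

text \<open>Every complete cycle of \<open>K\<close> rounds contributes one pull of arm
  \<open>i\<close>, namely in round \<open>k * K + i\<close>.\<close>

lemma num_samples_ge:
  assumes "i \<in> {1..K}"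
  shows "L div K \<le> num_samples K L i"
proof -
  let ?f = "\<lambda>k. k * K + i"
  have "?f ` {..<L div K} \<subseteq> {t \<in> {1..L}. round_robin K t = i}"
  proof safe
    fix k assume "k < L div K"
    then have "(k + 1) * K \<le> (L div K) * K" by (intro mult_le_mono1) simp
    also have "\<dots> \<le> L" by simp
    finally show "k * K + i \<in> {1..L}" using assms by simp
    have "(k * K + i - 1) mod K = i - 1" using assms by (cases i) auto
    then show "round_robin K (k * K + i) = i"
      unfolding round_robin_def using assms by simp
  qed
  then have "card (?f ` {..<L div K}) \<le> num_samples K L i"
    unfolding num_samples_def by (intro card_mono) simp_all
  moreover have "inj_on ?f {..<L div K}" using assms by (auto simp: inj_on_def)
  ultimately show ?thesis by (simp add: card_image)
qed

lemma num_blocks_log_pos: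
  assumes "2 \<le> K" "1 \<le> T"
  shows "0 < ln (real K * real T ^ 3)"
proof -
  have "1 * 1 < real K * real T ^ 3"
    using assms by (intro mult_less_le_imp_less) auto
  then show ?thesis by simp
qed

lemma num_blocks_pos:
  assumes "2 \<le> K" "1 \<le> T"
  shows "1 \<le> num_blocks K T"
  using num_blocks_log_pos[OF assms] by (simp add: num_blocks_def Suc_le_eq)

text \<open>\<open>K \<le> T\<close> turns \<open>ln K\<close> into \<open>ln T\<close>, which gives
  at most \<open>32 ln T + 1\<close>. This condition holds whenever the algorithm commits.\<close>

lemma num_blocks_upper:
  assumes "2 \<le> K" "K \<le> T"
  shows "real (num_blocks K T) \<le> 33 * (1 + ln (real T))"
proof -
  define x where "x = ln (real K * real T ^ 3)"
  have "0 < x" using num_blocks_log_pos assms by (simp add: x_def)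
  then have "real (num_blocks K T) \<le> 8 * x + 1"
    unfolding num_blocks_def x_def[symmetric] by (intro nat_ceiling_le_add_one) simp
  moreover have "x = ln (real K) + 3 * ln (real T)"
    using assms by (simp add: x_def ln_mult ln_realpow)
  moreover have "ln (real K) \<le> ln (real T)" "0 \<le> ln (real T)" using assms by simp_all
  ultimately show ?thesis by argo
qed

lemma exp_num_blocks_le:
  assumes "2 \<le> K" "1 \<le> T"
  shows "exp (- real (num_blocks K T) / 8) \<le> 1 / (real K * real T ^ 3)"
proof -
  have "8 * ln (real K * real T ^ 3) \<le> real (num_blocks K T)"
    unfolding num_blocks_def by (rule real_nat_ceiling_ge)
  then have "exp (- real (num_blocks K T) / 8) \<le> exp (- ln (real K * real T ^ 3))"
    by simp
  also have "\<dots> = 1 / (real K * real T ^ 3)"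
    using assms by (simp add: exp_minus divide_inverse)
  finally show ?thesis .
qed

section \<open>Exponents and sample sizes under the conditions on \<alpha> and q\<close>

context
  fixes \<epsilon> \<alpha> q :: real
  assumes \<epsilon>: "0 < \<epsilon>" and \<alpha>: "(1 + \<epsilon>) / (1 + 2 * \<epsilon>) \<le> \<alpha>" "\<alpha> < 1"
    and q: "0 \<le> q" "q \<le> \<epsilon> / (1 + 2 * \<epsilon>)"
begin

lemma explore_exponent_bounds:
  "0 \<le> explore_exponent \<epsilon> \<alpha>" "explore_exponent \<epsilon> \<alpha> \<le> \<alpha>"
proof -
  have "1 + \<epsilon> \<le> \<alpha> * (1 + 2 * \<epsilon>)" using \<alpha> \<epsilon> by (simp add: pos_divide_le_eq)
  then have "(1 - \<alpha>) * (1 + \<epsilon>) \<le> \<alpha> * \<epsilon>" by (simp add: algebra_simps)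
  then show "explore_exponent \<epsilon> \<alpha> \<le> \<alpha>"
    using \<epsilon> by (simp add: explore_exponent_def pos_divide_le_eq)
  show "0 \<le> explore_exponent \<epsilon> \<alpha>"
    using \<epsilon> \<alpha> by (simp add: explore_exponent_def)
qed

text \<open>The value \<open>\<epsilon> / (1 + 2 * \<epsilon>)\<close> is the fixed point of the
  decreasing map from \<open>q\<close> to \<open>\<epsilon> / (1 + \<epsilon>) * (1 - q)\<close>. So
  for \<open>q\<close> up to it, the image stays above both \<open>q\<close> and the fixed point,
  and the latter is at least \<open>1 - \<alpha>\<close> by the lower bound on \<alpha>.\<close>

lemma arms_exponent_bounds:
  "q \<le> \<epsilon> / (1 + \<epsilon>) * (1 - q)" "1 - \<alpha> \<le> \<epsilon> / (1 + \<epsilon>) * (1 - q)"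
  "0 \<le> \<epsilon> / (1 + \<epsilon>) * (1 - q)" "\<epsilon> / (1 + \<epsilon>) * (1 - q) \<le> 1"
proof -
  have qq: "q * (1 + 2 * \<epsilon>) \<le> \<epsilon>" using q \<epsilon> by (simp add: pos_le_divide_eq)
  then have "q * (1 + \<epsilon>) \<le> \<epsilon> * (1 - q)" by (simp add: algebra_simps)
  then show 1: "q \<le> \<epsilon> / (1 + \<epsilon>) * (1 - q)" using \<epsilon> by (simp add: pos_le_divide_eq)
  then show "0 \<le> \<epsilon> / (1 + \<epsilon>) * (1 - q)" using q by linarith
  have "1 - \<epsilon> / (1 + 2 * \<epsilon>) = (1 + \<epsilon>) / (1 + 2 * \<epsilon>)" using \<epsilon> by (simp add: field_simps)
  then have "\<epsilon> / (1 + 2 * \<epsilon>) = \<epsilon> / (1 + \<epsilon>) * (1 - \<epsilon> / (1 + 2 * \<epsilon>))"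
    using \<epsilon> by simp
  also have "\<dots> \<le> \<epsilon> / (1 + \<epsilon>) * (1 - q)"
    using q \<epsilon> by (intro mult_left_mono) auto
  finally have "\<epsilon> / (1 + 2 * \<epsilon>) \<le> \<epsilon> / (1 + \<epsilon>) * (1 - q)" .
  moreover have "1 - (1 + \<epsilon>) / (1 + 2 * \<epsilon>) = \<epsilon> / (1 + 2 * \<epsilon>)"
    using \<epsilon> by (simp add: field_simps)
  ultimately show "1 - \<alpha> \<le> \<epsilon> / (1 + \<epsilon>) * (1 - q)" using \<alpha> by linarith
  have "\<epsilon> / (1 + 2 * \<epsilon>) \<le> 1" using \<epsilon> by simp
  then have "q \<le> 1" using q by linarith
  then have "\<epsilon> / (1 + \<epsilon>) * (1 - q) \<le> 1 * 1" using q \<epsilon> by (intro mult_mono) auto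
  then show "\<epsilon> / (1 + \<epsilon>) * (1 - q) \<le> 1" by simp
qed

text \<open>Interpolation: write the minimum as a product of powers with exponents \<gamma> and
  \<open>1 - \<gamma> \<le> \<alpha>\<close>, and bound the first by \<open>K\<close>, the second by
  \<open>T\<close>. This one estimate bounds \<open>K\<close> when \<open>K \<le> T\<close>, bounds
  \<open>T\<close> when \<open>K > T\<close>, and shows that the target rate is at least 1.\<close>

lemma min_le_arms_horizon:
  assumes "1 \<le> K" "1 \<le> T"
  shows "min (real K) (real T) \<le> real K powr (\<epsilon> / (1 + \<epsilon>) * (1 - q)) * real T powr \<alpha>"
proof -
  define \<gamma> where "\<gamma> = \<epsilon> / (1 + \<epsilon>) * (1 - q)"
  have \<gamma>: "0 \<le> \<gamma>" "\<gamma> \<le> 1" "1 - \<alpha> \<le> \<gamma>"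
    using arms_exponent_bounds by (simp_all add: \<gamma>_def)
  define m where "m = min (real K) (real T)"
  have m: "1 \<le> m" "m \<le> real K" "m \<le> real T" using assms by (auto simp: m_def)
  have "m = m powr (\<gamma> + (1 - \<gamma>))" using m by simp
  also have "\<dots> = m powr \<gamma> * m powr (1 - \<gamma>)" by (simp only: powr_add)
  also have "\<dots> \<le> real K powr \<gamma> * real T powr (1 - \<gamma>)"
    using m \<gamma> by (intro mult_mono powr_mono2) auto
  also have "\<dots> \<le> real K powr \<gamma> * real T powr \<alpha>"
    using assms \<gamma> by (intro mult_left_mono powr_mono) auto
  finally show ?thesis by (simp add: m_def \<gamma>_def)
qed

lemma explore_length_le:
  assumes K: "2 \<le> K" and T: "1 \<le> T"
  shows "real (explore_length K T \<epsilon> \<alpha> q)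
    \<le> 35 * (1 + ln (real T)) * (real K powr (\<epsilon> / (1 + \<epsilon>) * (1 - q)) * real T powr \<alpha>)"
proof -
  define G where "G = real K powr (\<epsilon> / (1 + \<epsilon>) * (1 - q)) * real T powr \<alpha>"
  have mG: "min (real K) (real T) \<le> G"
    unfolding G_def using K T by (intro min_le_arms_horizon) auto
  then have G: "1 \<le> G" using K T by linarith
  have lnT: "0 \<le> ln (real T)" using T by simp
  have absorb: "a * G \<le> a * (1 + ln (real T)) * G" if "0 \<le> a" for a
    using that G lnT by (intro mult_right_mono) (auto simp: algebra_simps)
  show ?thesis
  proof (cases "K \<le> T")
    \<comment> \<open>With more arms than rounds the cut-off at \<open>T\<close> suffices, so no
      logarithm of \<open>K\<close> enters.\<close>
    case False
    then have "real (explore_length K T \<epsilon> \<alpha> q) \<le> 1 * G"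
      using mG by (simp add: explore_length_def)
    also have "\<dots> \<le> 35 * G" using G by simp
    also note absorb[of 35]
    finally show ?thesis by (simp add: G_def)
  next
    case True
    have "real K * real (num_blocks K T) \<le> G * (33 * (1 + ln (real T)))"
      using True mG num_blocks_upper[OF K True] by (intro mult_mono) auto
    moreover have "real (nat \<lceil>real K powr q * real T powr explore_exponent \<epsilon> \<alpha>\<rceil>)
        \<le> real K powr q * real T powr explore_exponent \<epsilon> \<alpha> + 1"
      by (intro nat_ceiling_le_add_one) simp
    moreover have "real K powr q * real T powr explore_exponent \<epsilon> \<alpha> \<le> G"
      unfolding G_def using K T arms_exponent_bounds explore_exponent_bounds
      by (intro mult_mono powr_mono) auto
    moreover have "explore_length K T \<epsilon> \<alpha> q \<le> K * num_blocks K T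
        + nat \<lceil>real K powr q * real T powr explore_exponent \<epsilon> \<alpha>\<rceil>"
      by (simp add: explore_length_def)
    then have "real (explore_length K T \<epsilon> \<alpha> q) \<le> real K * real (num_blocks K T)
        + real (nat \<lceil>real K powr q * real T powr explore_exponent \<epsilon> \<alpha>\<rceil>)"
      by (simp only: of_nat_le_iff flip: of_nat_mult of_nat_add)
    ultimately have "real (explore_length K T \<epsilon> \<alpha> q) \<le> G * (33 * (1 + ln (real T))) + 2 * G"
      using G by linarith
    also have "\<dots> \<le> G * (33 * (1 + ln (real T))) + 2 * (1 + ln (real T)) * G"
      using absorb[of 2] by simp
    finally show ?thesis by (simp add: G_def algebra_simps)
  qed
qed

text \<open>If exploration stops before \<open>T\<close>, the minimum is its second argument; then
  \<open>K \<le> K * num_blocks K T \<le> L < T\<close>.\<close>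

lemma explore_length_committed:
  assumes "2 \<le> K" "1 \<le> T" and L: "explore_length K T \<epsilon> \<alpha> q < T"
  shows "K * num_blocks K T \<le> explore_length K T \<epsilon> \<alpha> q" "K \<le> T"
    "real K powr q * real T powr explore_exponent \<epsilon> \<alpha> \<le> real (explore_length K T \<epsilon> \<alpha> q)"
proof -
  have eq: "explore_length K T \<epsilon> \<alpha> q
      = K * num_blocks K T + nat \<lceil>real K powr q * real T powr explore_exponent \<epsilon> \<alpha>\<rceil>"
    using L unfolding explore_length_def by linarith
  show 1: "K * num_blocks K T \<le> explore_length K T \<epsilon> \<alpha> q" by (simp add: eq)
  have "K * 1 \<le> K * num_blocks K T" using num_blocks_pos assms by (intro mult_le_mono2) auto
  then show "K \<le> T" using 1 L by linarith
  have "real K powr q * real T powr explore_exponent \<epsilon> \<alpha>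
      \<le> real (nat \<lceil>real K powr q * real T powr explore_exponent \<epsilon> \<alpha>\<rceil>)"
    by (rule real_nat_ceiling_ge)
  also have "\<dots> \<le> real (explore_length K T \<epsilon> \<alpha> q)" by (simp add: eq)
  finally show "real K powr q * real T powr explore_exponent \<epsilon> \<alpha> \<le> real (explore_length K T \<epsilon> \<alpha> q)" .
qed

text \<open>The summand \<open>K * num_blocks K T\<close> of the exploration length makes every
  block nonempty, and the power term makes it large. The factor 4 comes from two roundings, rounds
  to pulls per arm and pulls to block size.\<close>

lemma block_size_ge:
  assumes K: "2 \<le> K" and T: "1 \<le> T" and L: "explore_length K T \<epsilon> \<alpha> q < T" and i: "i \<in> {1..K}"
  defines "s \<equiv> num_samples K (explore_length K T \<epsilon> \<alpha> q) i div num_blocks K T"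
  shows "1 \<le> s"
    "real K powr q * real T powr explore_exponent \<epsilon> \<alpha> / (4 * real K * real (num_blocks K T)) \<le> real s"
proof -
  let ?L = "explore_length K T \<epsilon> \<alpha> q" and ?B = "num_blocks K T"
  note com = explore_length_committed[OF K T L]
  have B: "1 \<le> ?B" by (rule num_blocks_pos[OF K T])
  have n: "?L div K \<le> num_samples K ?L i" by (rule num_samples_ge[OF i])
  have BL: "?B \<le> ?L div K" using com(1) K by (simp add: less_eq_div_iff_mult_less_eq mult.commute)
  then have Bn: "?B \<le> num_samples K ?L i" using n by linarith
  show "1 \<le> s" unfolding s_def using B Bn by (simp add: Suc_le_eq div_greater_zero_iff)
  have KL: "K \<le> ?L" using com(1) B K by (metis mult.right_neutral mult_le_mono2 order_trans)
  have "real K powr q * real T powr explore_exponent \<epsilon> \<alpha> / (4 * real K * real ?B)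
      \<le> real ?L / (4 * real K * real ?B)"
    using com(3) by (intro divide_right_mono) auto
  also have "\<dots> = (real ?L / (2 * real K)) / (2 * real ?B)" by simp
  also have "\<dots> \<le> real (?L div K) / (2 * real ?B)"
    using div_ge_half[OF _ KL] K by (intro divide_right_mono) auto
  also have "\<dots> \<le> real (num_samples K ?L i) / (2 * real ?B)"
    using n by (intro divide_right_mono) auto
  also have "\<dots> \<le> real s"
    unfolding s_def using div_ge_half[OF _ Bn] B by simp
  finally show "real K powr q * real T powr explore_exponent \<epsilon> \<alpha> / (4 * real K * real ?B) \<le> real s" .
qed

lemma horizon_block_size_le:
  assumes K: "2 \<le> K" and T: "1 \<le> T" and L: "explore_length K T \<epsilon> \<alpha> q < T" and i: "i \<in> {1..K}"
  defines "s \<equiv> num_samples K (explore_length K T \<epsilon> \<alpha> q) i div num_blocks K T"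
  shows "real T * real s powr (- \<epsilon> / (1 + \<epsilon>))
    \<le> 132 * (1 + ln (real T)) * (real K powr (\<epsilon> / (1 + \<epsilon>) * (1 - q)) * real T powr \<alpha>)"
proof -
  let ?B = "real (num_blocks K T)" and ?\<beta> = "explore_exponent \<epsilon> \<alpha>"
  define \<kappa> where "\<kappa> = \<epsilon> / (1 + \<epsilon>)"
  have \<kappa>: "0 \<le> \<kappa>" "\<kappa> \<le> 1" using \<epsilon> by (auto simp: \<kappa>_def)
  have B: "1 \<le> ?B" using num_blocks_pos[OF K T] by simp
  define r where "r = real K powr q * real T powr ?\<beta> / (4 * real K * ?B)"
  have r: "0 < r" using K T B by (simp add: r_def)
  have rs: "r \<le> real s" unfolding r_def s_def by (rule block_size_ge(2)[OF K T L i])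
  have r_eq: "r = real K powr (q - 1) * real T powr ?\<beta> * inverse (4 * ?B)"
    using K by (simp add: r_def powr_diff field_simps)
  have "real T * real s powr (- \<kappa>) \<le> real T * r powr (- \<kappa>)"
    using rs r \<kappa> by (intro mult_left_mono powr_mono2') auto
  also have "r powr (- \<kappa>) = (real K powr (q - 1)) powr (- \<kappa>) * (real T powr ?\<beta>) powr (- \<kappa>)
      * (inverse (4 * ?B)) powr (- \<kappa>)"
    unfolding r_eq by (simp only: powr_mult)
  also have "(real K powr (q - 1)) powr (- \<kappa>) = real K powr (\<kappa> * (1 - q))"
    by (simp add: powr_powr algebra_simps)
  also have "(real T powr ?\<beta>) powr (- \<kappa>) = real T powr (\<alpha> - 1)"
  proof -
    \<comment> \<open>This identity explains the exploration exponent: one commitment round costs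
      about \<open>T powr (\<alpha> - 1)\<close>, hence all of them about
      \<open>T powr \<alpha>\<close>.\<close>
    have "?\<beta> * (- \<kappa>) = \<alpha> - 1" using \<epsilon> by (simp add: explore_exponent_def \<kappa>_def)
    then show ?thesis by (simp only: powr_powr)
  qed
  also have "(inverse (4 * ?B)) powr (- \<kappa>) = (4 * ?B) powr \<kappa>"
    using B by (simp add: powr_minus inverse_powr del: inverse_mult_distrib)
  also have "real T * (real K powr (\<kappa> * (1 - q)) * real T powr (\<alpha> - 1) * (4 * ?B) powr \<kappa>)
      = (4 * ?B) powr \<kappa> * (real K powr (\<kappa> * (1 - q)) * real T powr \<alpha>)"
    using T by (simp add: powr_diff)
  also have "\<dots> \<le> (4 * ?B) * (real K powr (\<kappa> * (1 - q)) * real T powr \<alpha>)"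
  proof (rule mult_right_mono)
    have "(4 * ?B) powr \<kappa> \<le> (4 * ?B) powr 1" using B \<kappa> by (intro powr_mono) auto
    then show "(4 * ?B) powr \<kappa> \<le> 4 * ?B" using B by simp
  qed simp
  also have "\<dots> \<le> (132 * (1 + ln (real T))) * (real K powr (\<kappa> * (1 - q)) * real T powr \<alpha>)"
    using num_blocks_upper[OF K explore_length_committed(2)[OF K T L]] by (intro mult_right_mono) auto
  finally show ?thesis by (simp add: \<kappa>_def)
qed

end

section \<open>Regret\<close>

text \<open>The blocks end at \<open>B * (n div B) \<le> n\<close>. The lemma is for the commitment
  rule, which sees the rewards restricted to the exploration indices and \<open>undefined\<close>
  elsewhere.\<close>

lemma median_of_means_cong:
  assumes "\<And>l. l \<in> {1..n} \<Longrightarrow> x l = y l"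
  shows "median_of_means B n x = median_of_means B n y"
proof -
  have "block_mean (n div B) x b = block_mean (n div B) y b" if "b \<in> set [1..<Suc B]" for b
  proof -
    have "b * (n div B) \<le> B * (n div B)" using that by (intro mult_le_mono1) auto
    also have "\<dots> \<le> n" by simp
    finally have "b * (n div B) \<le> n" .
    then show ?thesis unfolding block_mean_def using assms
      by (intro arg_cong2[where f = "(/)"] sum.cong) auto
  qed
  then have "map (block_mean (n div B) x) [1..<Suc B] = map (block_mean (n div B) y) [1..<Suc B]"
    by (intro map_cong refl)
  then show ?thesis unfolding median_of_means_def by (simp only:)
qed

lemma num_samples_in_explore_indices:
  assumes "i \<in> {1..K}" "l \<in> {1..num_samples K L i}"
  shows "(i, l) \<in> explore_indices K L"
  using assms by (simp add: explore_indices_def)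

section \<open>Regret on a fixed heavy-tailed instance\<close>

context
  fixes K :: nat and \<epsilon> u :: real and \<nu> :: "nat \<Rightarrow> real measure"
  assumes K: "2 \<le> K" and \<epsilon>: "0 < \<epsilon>" "\<epsilon> \<le> 1" and u: "0 < u"
    and \<nu>: "\<nu> \<in> heavy_tailed_instances K \<epsilon> u"
begin

lemma arm_real_distribution: "i \<in> {1..K} \<Longrightarrow> real_distribution (\<nu> i)"
  using \<nu> by (simp add: heavy_tailed_instances_def)

lemma arm_moment:
  assumes i: "i \<in> {1..K}"
  shows "integrable (\<nu> i) (\<lambda>x. \<bar>x\<bar> powr (1 + \<epsilon>))" "(\<integral>x. \<bar>x\<bar> powr (1 + \<epsilon>) \<partial>\<nu> i) \<le> u"
proof -
  interpret real_distribution "\<nu> i" by (rule arm_real_distribution[OF i])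
  have le: "(\<integral>\<^sup>+ x. ennreal (\<bar>x\<bar> powr (1 + \<epsilon>)) \<partial>\<nu> i) \<le> ennreal u"
    using \<nu> i by (simp add: heavy_tailed_instances_def)
  also have "\<dots> < \<infinity>" by simp
  finally show int: "integrable (\<nu> i) (\<lambda>x. \<bar>x\<bar> powr (1 + \<epsilon>))"
    by (intro integrableI_nonneg) auto
  have "ennreal (\<integral>x. \<bar>x\<bar> powr (1 + \<epsilon>) \<partial>\<nu> i) \<le> ennreal u"
    using le nn_integral_eq_integral[OF int] by simp
  then show "(\<integral>x. \<bar>x\<bar> powr (1 + \<epsilon>) \<partial>\<nu> i) \<le> u" using u by (simp add: ennreal_le_iff)
qed

lemma abs_arm_mean_le:
  assumes i: "i \<in> {1..K}"
  shows "\<bar>arm_mean \<nu> i\<bar> \<le> 2 * u powr (1 / (1 + \<epsilon>))"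
proof -
  interpret real_distribution "\<nu> i" by (rule arm_real_distribution[OF i])
  show ?thesis
    unfolding arm_mean_def
    by (rule abs_expectation_le_moment[OF _ \<epsilon>(1) u arm_moment[OF i]]) simp
qed

lemma best_mean_attained: obtains j where "j \<in> {1..K}" "best_mean K \<nu> = arm_mean \<nu> j"
proof -
  have "best_mean K \<nu> \<in> arm_mean \<nu> ` {1..K}"
    unfolding best_mean_def using K by (intro Max_in) auto
  then show ?thesis using that by auto
qed

lemma arm_mean_le_best_mean: "i \<in> {1..K} \<Longrightarrow> arm_mean \<nu> i \<le> best_mean K \<nu>"
  unfolding best_mean_def by (intro Max_ge) auto

lemma gap_le:
  assumes i: "i \<in> {1..K}"
  shows "best_mean K \<nu> - arm_mean \<nu> i \<le> 4 * u powr (1 / (1 + \<epsilon>))"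
proof -
  obtain j where "j \<in> {1..K}" "best_mean K \<nu> = arm_mean \<nu> j" by (rule best_mean_attained)
  then show ?thesis using abs_arm_mean_le[of j] abs_arm_mean_le[OF i] by linarith
qed

lemma prob_space_reward_space: "prob_space (reward_space K \<nu>)"
  unfolding reward_space_def using arm_real_distribution real_distribution.axioms(1)
  by (intro prob_space_PiM) auto

lemma arm_median_of_means_concentration:
  assumes i: "i \<in> {1..K}" and B: "1 \<le> B" and s: "1 \<le> n div B"
  shows "\<exists>E \<in> sets (reward_space K \<nu>). measure (reward_space K \<nu>) E \<le> exp (- real B / 8) \<and>
    (\<forall>\<omega> \<in> space (reward_space K \<nu>) - E. \<bar>median_of_means B n (\<lambda>l. \<omega> (i, l)) - arm_mean \<nu> i\<bar>
      \<le> 19 * u powr (1 / (1 + \<epsilon>)) * real (n div B) powr (- \<epsilon> / (1 + \<epsilon>)))"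
proof -
  interpret N: real_distribution "\<nu> i" by (rule arm_real_distribution[OF i])
  interpret P: prob_space "reward_space K \<nu>" by (rule prob_space_reward_space)
  have ps: "prob_space ((\<lambda>(i, l). \<nu> i) p)" if "p \<in> {1..K} \<times> {1::nat..}" for p
    using that arm_real_distribution real_distribution.axioms(1) by auto
  have coord: "(i, l) \<in> {1..K} \<times> {1..}" if "l \<in> {1..n}" for l
    using i that by simp
  have "P.indep_vars (\<lambda>l. \<nu> i) (\<lambda>l \<omega>. \<omega> (i, l)) {1..n}"
    using indep_vars_PiM_coordinates[of "{1..K} \<times> {1..}" "\<lambda>(i, l). \<nu> i" "Pair i" "{1..n}", OF ps]
      coord unfolding reward_space_def by (simp add: inj_on_def)
  \<comment> \<open>Composing with the identity replaces the target space \<open>\<nu> i\<close> by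
    \<open>borel\<close>, the form in which the concentration lemma is stated.\<close>
  then have indep: "P.indep_vars (\<lambda>_. borel) (\<lambda>l \<omega>. \<omega> (i, l)) {1..n}"
    by (rule P.indep_vars_compose2[where Y = "\<lambda>_ x. x"]) simp
  have "distr (reward_space K \<nu>) (case p of (i, l) \<Rightarrow> \<nu> i) (\<lambda>\<omega>. \<omega> p) = (case p of (i, l) \<Rightarrow> \<nu> i)"
    if "p \<in> {1..K} \<times> {1..}" for p
    unfolding reward_space_def by (rule distr_PiM_component) (use ps that in auto)
  from this[OF coord] have distr: "distr (reward_space K \<nu>) (\<nu> i) (\<lambda>\<omega>. \<omega> (i, l)) = \<nu> i"
    if "l \<in> {1..n}" for l
    using that by simp
  have meas: "(\<lambda>\<omega>. \<omega> (i, l)) \<in> measurable (reward_space K \<nu>) (\<nu> i)" if "l \<in> {1..n}" for l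
    using measurable_component_singleton[OF coord[OF that], of "\<lambda>(i, l). \<nu> i"]
    unfolding reward_space_def by simp
  show ?thesis
  proof (rule P.median_of_means_concentration[OF B s indep \<epsilon> u])
    fix l assume l: "l \<in> {1..n}"
    have "integrable (distr (reward_space K \<nu>) (\<nu> i) (\<lambda>\<omega>. \<omega> (i, l))) (\<lambda>x. \<bar>x\<bar> powr (1 + \<epsilon>))"
      unfolding distr[OF l] by (rule arm_moment(1)[OF i])
    then show "integrable (reward_space K \<nu>) (\<lambda>\<omega>. \<bar>\<omega> (i, l)\<bar> powr (1 + \<epsilon>))"
      by (subst (asm) integrable_distr_eq[OF meas[OF l]]) auto
    have "P.expectation (\<lambda>\<omega>. \<bar>\<omega> (i, l)\<bar> powr (1 + \<epsilon>))
        = (\<integral>x. \<bar>x\<bar> powr (1 + \<epsilon>) \<partial>distr (reward_space K \<nu>) (\<nu> i) (\<lambda>\<omega>. \<omega> (i, l)))"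
      by (rule integral_distr[OF meas[OF l], symmetric]) simp
    then show "P.expectation (\<lambda>\<omega>. \<bar>\<omega> (i, l)\<bar> powr (1 + \<epsilon>)) \<le> u"
      using arm_moment(2)[OF i] by (simp add: distr[OF l])
    have "P.expectation (\<lambda>\<omega>. \<omega> (i, l))
        = (\<integral>x. x \<partial>distr (reward_space K \<nu>) (\<nu> i) (\<lambda>\<omega>. \<omega> (i, l)))"
      by (rule integral_distr[OF meas[OF l], symmetric]) simp
    then show "P.expectation (\<lambda>\<omega>. \<omega> (i, l)) = arm_mean \<nu> i"
      by (simp add: distr[OF l] arm_mean_def)
  qed
qed

text \<open>Exploration rounds are charged the worst possible gap, later rounds \<open>r\<close>
  each; the number of the latter is bounded by \<open>T\<close>.\<close>

lemma regret_sum_le: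
  assumes L: "L \<le> T" and I_explore: "\<And>t. t \<in> {1..L} \<Longrightarrow> I t \<in> {1..K}"
    and I_commit: "\<And>t. t \<in> {Suc L..T} \<Longrightarrow> best_mean K \<nu> - arm_mean \<nu> (I t) \<le> r"
    and r: "0 \<le> r"
  shows "(\<Sum>t = 1..T. best_mean K \<nu> - arm_mean \<nu> (I t))
    \<le> real L * (4 * u powr (1 / (1 + \<epsilon>))) + real T * r"
proof -
  have "(\<Sum>t = 1..T. best_mean K \<nu> - arm_mean \<nu> (I t))
      = (\<Sum>t \<in> {1..L}. best_mean K \<nu> - arm_mean \<nu> (I t)) + (\<Sum>t \<in> {Suc L..T}. best_mean K \<nu> - arm_mean \<nu> (I t))"
  proof -
    have "{1..T} = {1..L} \<union> {Suc L..T}" using L by auto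
    then show ?thesis by (simp add: sum.union_disjoint)
  qed
  also have "(\<Sum>t \<in> {1..L}. best_mean K \<nu> - arm_mean \<nu> (I t)) \<le> of_nat (card {1..L}) * (4 * u powr (1 / (1 + \<epsilon>)))"
    by (intro sum_bounded_above gap_le I_explore)
  also have "(\<Sum>t \<in> {Suc L..T}. best_mean K \<nu> - arm_mean \<nu> (I t)) \<le> of_nat (card {Suc L..T}) * r"
    by (intro sum_bounded_above I_commit)
  also have "of_nat (card {Suc L..T}) * r \<le> real T * r"
    using r by (intro mult_right_mono) auto
  finally show ?thesis by simp
qed

text \<open>For a best arm \<open>j\<close>, its mean is at most
  \<open>m j + \<delta> \<le> m c + \<delta>\<close>, which exceeds the mean of \<open>c\<close> by
  at most \<open>2 * \<delta>\<close>.\<close>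

lemma argmax_gap_le:
  assumes close: "\<And>i. i \<in> {1..K} \<Longrightarrow> \<bar>m i - arm_mean \<nu> i\<bar> \<le> \<delta>"
    and c: "is_arg_max m (\<lambda>i. i \<in> {1..K}) c"
  shows "best_mean K \<nu> - arm_mean \<nu> c \<le> 2 * \<delta>"
proof -
  obtain j where j: "j \<in> {1..K}" "best_mean K \<nu> = arm_mean \<nu> j" by (rule best_mean_attained)
  have "c \<in> {1..K}" "m j \<le> m c" using c j(1) by (auto simp: is_arg_max_def not_less)
  then show ?thesis using close[of c] close[OF j(1)] j(2) by linarith
qed

lemma round_robin_range: "t \<ge> 1 \<Longrightarrow> round_robin K t \<in> {1..K}"
  using K by (simp add: round_robin_def Suc_le_eq)

lemma expected_regret_full_exploration:
  assumes L: "explore_length K T \<epsilon> \<alpha> q = T"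
  shows "expected_regret K T \<nu> (adar_etc K T \<epsilon> \<alpha> q c) \<le> real T * (4 * u powr (1 / (1 + \<epsilon>)))"
proof -
  interpret P: prob_space "reward_space K \<nu>" by (rule prob_space_reward_space)
  have "expected_regret K T \<nu> (adar_etc K T \<epsilon> \<alpha> q c)
      \<le> (\<integral>\<omega>. real T * (4 * u powr (1 / (1 + \<epsilon>))) + real T * 0 \<partial>reward_space K \<nu>)"
    unfolding expected_regret_def
  proof (intro integral_mono' regret_sum_le)
    fix \<omega> t assume "t \<in> {1..T}"
    then show "adar_etc K T \<epsilon> \<alpha> q c t \<omega> \<in> {1..K}"
      using round_robin_range by (simp add: adar_etc_def L)
  qed auto
  then show ?thesis by (simp add: P.prob_space)
qed

text \<open>Comparing with an integrable upper bound makes the measurability of the regret irrelevant: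
  the Bochner integral of a non-integrable function is 0.\<close>
lemma expected_regret_commitment:
  assumes T: "1 \<le> T" and L: "explore_length K T \<epsilon> \<alpha> q < T" and c: "adar_etc_rule K T \<epsilon> \<alpha> q c"
    and \<delta>: "\<And>i. i \<in> {1..K} \<Longrightarrow> 19 * u powr (1 / (1 + \<epsilon>)) *
        real (num_samples K (explore_length K T \<epsilon> \<alpha> q) i div num_blocks K T) powr (- \<epsilon> / (1 + \<epsilon>)) \<le> \<delta>"
    and s: "\<And>i. i \<in> {1..K} \<Longrightarrow> 1 \<le> num_samples K (explore_length K T \<epsilon> \<alpha> q) i div num_blocks K T"
  shows "expected_regret K T \<nu> (adar_etc K T \<epsilon> \<alpha> q c)
    \<le> (real (explore_length K T \<epsilon> \<alpha> q) + 1) * (4 * u powr (1 / (1 + \<epsilon>))) + real T * (2 * \<delta>)"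
proof -
  interpret P: prob_space "reward_space K \<nu>" by (rule prob_space_reward_space)
  let ?L = "explore_length K T \<epsilon> \<alpha> q" and ?B = "num_blocks K T" and ?U = "4 * u powr (1 / (1 + \<epsilon>))"
  have B: "1 \<le> ?B" by (rule num_blocks_pos[OF K T])
  have "\<forall>i\<in>{1..K}. \<exists>E. E \<in> P.events \<and> P.prob E \<le> exp (- real ?B / 8) \<and>
      (\<forall>\<omega> \<in> space (reward_space K \<nu>) - E.
        \<bar>median_of_means ?B (num_samples K ?L i) (\<lambda>l. \<omega> (i, l)) - arm_mean \<nu> i\<bar>
          \<le> 19 * u powr (1 / (1 + \<epsilon>)) * real (num_samples K ?L i div ?B) powr (- \<epsilon> / (1 + \<epsilon>)))" (is "\<forall>i\<in>_. ?Q i")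
  proof
    fix i assume i: "i \<in> {1..K}"
    from arm_median_of_means_concentration[OF i B s[OF i]] show "?Q i" unfolding Bex_def .
  qed
  from bchoice[OF this] obtain E where "\<forall>i\<in>{1..K}. E i \<in> P.events \<and>
      P.prob (E i) \<le> exp (- real ?B / 8) \<and> (\<forall>\<omega> \<in> space (reward_space K \<nu>) - E i.
        \<bar>median_of_means ?B (num_samples K ?L i) (\<lambda>l. \<omega> (i, l)) - arm_mean \<nu> i\<bar>
          \<le> 19 * u powr (1 / (1 + \<epsilon>)) * real (num_samples K ?L i div ?B) powr (- \<epsilon> / (1 + \<epsilon>)))" ..
  then have E: "\<And>i. i \<in> {1..K} \<Longrightarrow> E i \<in> P.events"
      "\<And>i. i \<in> {1..K} \<Longrightarrow> P.prob (E i) \<le> exp (- real ?B / 8)"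
      "\<And>i \<omega>. i \<in> {1..K} \<Longrightarrow> \<omega> \<in> space (reward_space K \<nu>) - E i \<Longrightarrow>
        \<bar>median_of_means ?B (num_samples K ?L i) (\<lambda>l. \<omega> (i, l)) - arm_mean \<nu> i\<bar>
          \<le> 19 * u powr (1 / (1 + \<epsilon>)) * real (num_samples K ?L i div ?B) powr (- \<epsilon> / (1 + \<epsilon>))"
    by blast+
  define F where "F = (\<Union>i\<in>{1..K}. E i)"
  have F_meas: "F \<in> P.events" unfolding F_def using E(1) by blast
  have "P.prob F \<le> (\<Sum>i\<in>{1..K}. P.prob (E i))"
    unfolding F_def using E(1) by (intro P.finite_measure_subadditive_finite) auto
  \<comment> \<open>The number of blocks is tuned to this union bound: the factor \<open>K\<close>
    cancels.\<close>
  also have "\<dots> \<le> of_nat (card {1..K}) * (1 / (real K * real T ^ 3))"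
    using E(2) exp_num_blocks_le[OF K T] by (intro sum_bounded_above) (rule order_trans)
  also have "\<dots> = 1 / real T ^ 3" using K by simp
  also have "\<dots> \<le> 1 / real T ^ 1"
    using T by (intro divide_left_mono power_increasing) auto
  finally have "real T * P.prob F \<le> 1" using T by (simp add: field_simps)
  \<comment> \<open>All rounds spent after a failure cost, in expectation, no more than one
    worst-case gap; this is the \<open>+ 1\<close> in the claim.\<close>
  then have F_prob: "real T * P.prob F * ?U \<le> 1 * ?U" by (intro mult_right_mono) auto
  have "0 \<le> 19 * u powr (1 / (1 + \<epsilon>)) * real (num_samples K ?L 1 div ?B) powr (- \<epsilon> / (1 + \<epsilon>))"
    by simp
  also have "\<dots> \<le> \<delta>" using K by (intro \<delta>) simp
  finally have \<delta>0: "0 \<le> \<delta>" .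
  \<comment> \<open>After commitment a round costs at most \<open>2 * \<delta>\<close> off
    \<open>F\<close> and at most the largest gap on \<open>F\<close>.\<close>
  have pointwise: "(\<Sum>t = 1..T. best_mean K \<nu> - arm_mean \<nu> (adar_etc K T \<epsilon> \<alpha> q c t \<omega>))
      \<le> real ?L * ?U + real T * (2 * \<delta> + ?U * indicator F \<omega>)"
    if \<omega>: "\<omega> \<in> space (reward_space K \<nu>)" for \<omega>
  proof (rule regret_sum_le)
    show "?L \<le> T" using L by simp
    show "adar_etc K T \<epsilon> \<alpha> q c t \<omega> \<in> {1..K}" if "t \<in> {1..?L}" for t
      using that round_robin_range by (simp add: adar_etc_def)
    show "0 \<le> 2 * \<delta> + ?U * indicator F \<omega>" using \<delta>0 by (simp add: indicator_def)
    fix t assume t: "t \<in> {Suc ?L..T}"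
    let ?a = "c (restrict \<omega> (explore_indices K ?L))"
    have "restrict \<omega> (explore_indices K ?L) \<in> space (\<Pi>\<^sub>M _ \<in> explore_indices K ?L. borel)"
      by (simp add: space_PiM)
    then have "is_arg_max (\<lambda>i. median_of_means ?B (num_samples K ?L i)
        (\<lambda>l. restrict \<omega> (explore_indices K ?L) (i, l))) (\<lambda>i. i \<in> {1..K}) ?a" (is "is_arg_max ?m _ _")
      using c unfolding adar_etc_rule_def commitment_rule_def by blast
    moreover have m: "?m i = median_of_means ?B (num_samples K ?L i) (\<lambda>l. \<omega> (i, l))" if "i \<in> {1..K}" for i
      using num_samples_in_explore_indices[OF that] by (intro median_of_means_cong) simp
    ultimately have "best_mean K \<nu> - arm_mean \<nu> ?a \<le> 2 * \<delta> + ?U * indicator F \<omega>"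
    proof (cases "\<omega> \<in> F")
      case True
      assume "is_arg_max ?m (\<lambda>i. i \<in> {1..K}) ?a"
      then have "?a \<in> {1..K}" by (simp add: is_arg_max_def)
      from gap_le[OF this] show ?thesis using True \<delta>0 by simp
    next
      case False
      assume arg: "is_arg_max ?m (\<lambda>i. i \<in> {1..K}) ?a"
      have "best_mean K \<nu> - arm_mean \<nu> ?a \<le> 2 * \<delta>"
      proof (rule argmax_gap_le[OF _ arg])
        fix i assume i: "i \<in> {1..K}"
        then have "\<omega> \<in> space (reward_space K \<nu>) - E i" using \<omega> False by (auto simp: F_def)
        from E(3)[OF i this] \<delta>[OF i] show "\<bar>?m i - arm_mean \<nu> i\<bar> \<le> \<delta>"
          unfolding m[OF i] by linarith
      qed
      then show ?thesis using False by simp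
    qed
    then show "best_mean K \<nu> - arm_mean \<nu> (adar_etc K T \<epsilon> \<alpha> q c t \<omega>) \<le> 2 * \<delta> + ?U * indicator F \<omega>"
      using t by (simp add: adar_etc_def Let_def)
  qed
  have "expected_regret K T \<nu> (adar_etc K T \<epsilon> \<alpha> q c)
      \<le> (\<integral>\<omega>. real ?L * ?U + real T * (2 * \<delta> + ?U * indicator F \<omega>) \<partial>reward_space K \<nu>)"
    unfolding expected_regret_def
  proof (rule integral_mono'[OF _ pointwise])
    show "integrable (reward_space K \<nu>) (\<lambda>\<omega>. real ?L * ?U + real T * (2 * \<delta> + ?U * indicator F \<omega>))"
      using F_meas by (simp add: P.emeasure_eq_measure)
  qed (use \<delta>0 in \<open>auto simp: indicator_def\<close>)
  also have "\<dots> = real ?L * ?U + real T * (2 * \<delta> + ?U * P.prob F)"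
    using F_meas by (simp add: P.emeasure_eq_measure P.prob_space)
  also have "\<dots> \<le> (real ?L + 1) * ?U + real T * (2 * \<delta>)"
    using F_prob by (simp add: algebra_simps)
  finally show ?thesis .
qed

end

section \<open>Choice of the constants\<close>

theorem theorem5:
  fixes \<epsilon> \<alpha> q :: real
  assumes "0 < \<epsilon>" and "\<epsilon> \<le> 1"
    and "(1 + \<epsilon>) / (1 + 2 * \<epsilon>) \<le> \<alpha>" and "\<alpha> < 1"
    and "0 \<le> q" and "q \<le> \<epsilon> / (1 + 2 * \<epsilon>)"
  shows "\<exists>C>0. \<exists>m>0. \<forall>(K::nat)\<ge>2. \<forall>(T::nat)\<ge>1. \<forall>c. adar_etc_rule K T \<epsilon> \<alpha> q c \<longrightarrow>
    (\<forall>u>0. \<forall>\<nu> \<in> heavy_tailed_instances K \<epsilon> u.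
       expected_regret K T \<nu> (adar_etc K T \<epsilon> \<alpha> q c)
         \<le> C * (1 + ln (real T)) powr m * u powr (1 / (1 + \<epsilon>))
             * real K powr (\<epsilon> / (1 + \<epsilon>) * (1 - q)) * real T powr \<alpha>)"
proof -
  note par = assms(1,3-6)
  \<comment> \<open>One logarithmic factor suffices, so \<open>m = 1\<close>. The constant rounds up
    \<open>4 * 36 + 2 * 19 * 132 = 5160\<close>, from exploration (with \<open>35 + 1 = 36\<close>)
    and commitment.\<close>
  have "expected_regret K T \<nu> (adar_etc K T \<epsilon> \<alpha> q c)
      \<le> 6000 * (1 + ln (real T)) powr 1 * u powr (1 / (1 + \<epsilon>))
             * real K powr (\<epsilon> / (1 + \<epsilon>) * (1 - q)) * real T powr \<alpha>"
    if K: "2 \<le> K" and T: "1 \<le> T" and c: "adar_etc_rule K T \<epsilon> \<alpha> q c"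
      and u: "0 < u" and \<nu>: "\<nu> \<in> heavy_tailed_instances K \<epsilon> u"
    for K T :: nat and c and u :: real and \<nu>
  proof -
    let ?L = "explore_length K T \<epsilon> \<alpha> q"
    define U where "U = u powr (1 / (1 + \<epsilon>))"
    define G where "G = (1 + ln (real T)) * (real K powr (\<epsilon> / (1 + \<epsilon>) * (1 - q)) * real T powr \<alpha>)"
    have U: "0 \<le> U" by (simp add: U_def)
    have lnT: "0 \<le> ln (real T)" using T by simp
    have G1: "1 \<le> G"
    proof -
      have "1 \<le> real K powr (\<epsilon> / (1 + \<epsilon>) * (1 - q)) * real T powr \<alpha>"
        using min_le_arms_horizon[OF par, of K T] K T by linarith
      from mult_mono[OF _ this, of 1 "1 + ln (real T)"] lnT show ?thesis by (simp add: G_def)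
    qed
    have L: "real ?L \<le> 35 * G"
      using explore_length_le[OF par K T] by (simp only: G_def mult.assoc)
    have "expected_regret K T \<nu> (adar_etc K T \<epsilon> \<alpha> q c) \<le> 6000 * (U * G)"
    proof (cases "?L < T")
      case False
      \<comment> \<open>Without commitment \<open>T\<close> is itself the exploration length and
        inherits its bound \<open>35 * G\<close>.\<close>
      then have LT: "?L = T" by (simp add: explore_length_def)
      have "expected_regret K T \<nu> (adar_etc K T \<epsilon> \<alpha> q c) \<le> real ?L * (4 * U)"
        using expected_regret_full_exploration[OF K assms(1,2) u \<nu> LT] by (simp add: LT U_def)
      also have "\<dots> \<le> (35 * G) * (4 * U)" using L U by (intro mult_right_mono) auto
      also have "\<dots> \<le> 6000 * (U * G)" using U G1 by simp
      finally show ?thesis .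
    next
      case True
      \<comment> \<open>\<open>horizon_block_size_le\<close> divided by \<open>T\<close>: one
        accuracy valid for all arms, although their sample counts may differ.\<close>
      define \<delta> where "\<delta> = 19 * U * (132 * G / real T)"
      have "19 * u powr (1 / (1 + \<epsilon>)) * real (num_samples K ?L i div num_blocks K T) powr (- \<epsilon> / (1 + \<epsilon>)) \<le> \<delta>"
        if i: "i \<in> {1..K}" for i
      proof -
        have "real T * real (num_samples K ?L i div num_blocks K T) powr (- \<epsilon> / (1 + \<epsilon>)) \<le> 132 * G"
          using horizon_block_size_le[OF par K T True i] by (simp only: G_def mult.assoc)
        then have "real (num_samples K ?L i div num_blocks K T) powr (- \<epsilon> / (1 + \<epsilon>)) \<le> 132 * G / real T"
          using T by (simp add: field_simps)
        then show ?thesis unfolding \<delta>_def U_def by (intro mult_left_mono) auto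
      qed
      from expected_regret_commitment[OF K assms(1,2) u \<nu> T True c this block_size_ge(1)[OF par K T True]]
      have "expected_regret K T \<nu> (adar_etc K T \<epsilon> \<alpha> q c) \<le> (real ?L + 1) * (4 * U) + real T * (2 * \<delta>)"
        by (simp add: U_def)
      also have "(real ?L + 1) * (4 * U) \<le> (36 * G) * (4 * U)"
        using L G1 U by (intro mult_right_mono) auto
      also have "real T * (2 * \<delta>) = 5016 * (U * G)" using T by (simp add: \<delta>_def)
      also have "(36 * G) * (4 * U) + 5016 * (U * G) \<le> 6000 * (U * G)" using U G1 by simp
      finally show ?thesis by simp
    qed
    moreover have "(1 + ln (real T)) powr 1 = 1 + ln (real T)" using lnT by simp
    ultimately show ?thesis by (simp only: U_def G_def mult_ac)
  qed
  then show ?thesis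
    by (intro exI[of _ 6000] exI[of _ 1] conjI) auto
qed

end
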